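(* Let $(E,\rho,[\cdot,\cdot]_E,L)$ be a regular local pre-Leibniz algebroid with a locality projector $\mathcal{P}$, and let $\nabla$ be an admissible linear $E$-connection. Then for every $v\in\mathfrak{X}(E)$ the following Cartan magic formulas hold on all $E$-$p$-forms: $$\mathcal{L}_v^\nabla=d(\nabla)\iota_v+\iota_vd(\nabla),\qquad \hat{\mathcal{L}}_v^\nabla=\hat d(\nabla)\iota_v+\iota_v\hat d(\nabla).$$
   Context: Everything is smooth. $M$ is a manifold, $E\to M$ a real vector bundle of constant rank, $\mathfrak{X}(E)=\Gamma(E)$, $\Omega^p(E)=\Gamma(\Lambda^pE^* )$, $\iota_v$ is the interior product. An anchored vector bundle $(E,\rho)$ has a vector bundle morphism $\rho:E\to T(M)$ over the identity; it is regular if $\ker\rho$ has locally constant rank. A pre-Leibniz algebroid $(E,\rho,[\cdot,\cdot]_E)$ is an anchored vector bundle with an $\mathbb{R}$-bilinear bracket on $\mathfrak{X}(E)$ satisfying $[u,fv]_E=\rho(u)(f)v+f[u,v]_E$ and $\rho([u,v]_E)=[\rho(u),\rho(v)]$. It is local with locality operator $L$, a $C^\infty(M,\mathbb{R})$-multilinear map $L:\Omega^1(E)\times\mathfrak{X}(E)\times\mathfrak{X}(E)\to\mathfrak{X}(E)$, if $[fu,v]_E=-\rho(v)(f)u+f[u,v]_E+L(Df,u,v)$, where $(Df)(u):=\rho(u)(f)$. A locality projector is a $C^\infty(M,\mathbb{R})$-linear map $\mathcal{P}:\mathfrak{X}(E)\to\mathfrak{X}(E)$ such that the image of $\mathcal{P}L$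 lies in $\ker\rho$ and $\mathcal{P}$ restricts to the identity on $\ker\rho$. A linear $E$-connection is an $\mathbb{R}$-bilinear map $\nabla:\mathfrak{X}(E)\times\mathfrak{X}(E)\to\mathfrak{X}(E)$ with $\nabla_u(fv)=\rho(u)(f)v+f\nabla_uv$ and $\nabla_{fu}v=f\nabla_uv$. $(X_a)$ denotes a local frame of $E$, $(e^a)$ the dual coframe, repeated indices are summed; $L(e^a,\nabla_{X_a}u,v)$ does not depend on the frame. $\nabla$ is admissible if $[u,v]_E+[v,u]_E=L(e^a,\nabla_{X_a}u,v)+L(e^a,\nabla_{X_a}v,u)$ for all $u,v$. Modified bracket: $[u,v]_E^\nabla:=[u,v]_E-L(e^a,\nabla_{X_a}u,v)$. Projected modified bracket: $[u,v]_E^{\hat\nabla}:=[u,v]_E-\mathcal{P}L(e^a,\nabla_{X_a}u,v)$. Both are anti-symmetric for admissible $\nabla$. The $E$-exterior derivative is $$d(\nabla)\Omega(v_1,\dots,v_{p+1}):=\sum_i(-1)^{i+1}\rho(v_i)\big(\Omega(v_1,\dots,\check v_i,\dots,v_{p+1})\big)+\sum_{i<j}(-1)^{i+j}\Omega([v_i,v_j]_E^\nabla,v_1,\dots,\check v_i,\dots,\check v_j,\dots,v_{p+1}),$$ where $\check v_i$ means omitted; $\hat d(\nabla)$ is given by the same formula with $[\cdot,\cdot]_E^{\hat\nabla}$. The $E$-Leibniz derivatives $\mathcal{L}_v^\nabla$ and $\hat{\mathcal{L}}_v^\nabla$ extend $[v,\cdot]_E^\nabla$ and $[v,\cdot]_E^{\hat\nabla}$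 to $E$-tensors as for the Lie derivative: they act on functions by $f\mapsto\rho(v)(f)$, and on $\Omega\in\Omega^p(E)$ by $(\mathcal{L}_v^\nabla\Omega)(v_1,\dots,v_p)=\rho(v)(\Omega(v_1,\dots,v_p))-\sum_i\Omega(v_1,\dots,[v,v_i]_E^\nabla,\dots,v_p)$, and similarly for $\hat{\mathcal{L}}_v^\nabla$ with $[\cdot,\cdot]_E^{\hat\nabla}$. *)

theory Defs
  imports "HOL-Analysis.Analysis"
begin

subsection \<open>Smooth functions on open subsets of \<open>\<real>\<^sup>n\<close>\<close>

text \<open>
  \<open>\<real>\<^sup>n\<close> is the library's \<open>Euclidean_space n\<close>: the functions \<open>x :: nat \<Rightarrow> real\<close> with \<open>x i = 0\<close>
  for \<open>i \<ge> n\<close>. This admits dimension 0.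
\<close>

definition partial_deriv :: "nat \<Rightarrow> ((nat \<Rightarrow> real) \<Rightarrow> real) \<Rightarrow> (nat \<Rightarrow> real) \<Rightarrow> real" where
  "partial_deriv i f x = deriv (\<lambda>t. f (x(i := t))) (x i)"

primrec Ck_on :: "nat \<Rightarrow> nat \<Rightarrow> (nat \<Rightarrow> real) set \<Rightarrow> ((nat \<Rightarrow> real) \<Rightarrow> real) \<Rightarrow> bool" where
  "Ck_on n 0 S f \<longleftrightarrow> continuous_map (subtopology (Euclidean_space n) S) euclideanreal f"
| "Ck_on n (Suc k) S f \<longleftrightarrow>
     continuous_map (subtopology (Euclidean_space n) S) euclideanreal f \<and>
     (\<forall>i<n. (\<forall>x\<in>S. (\<lambda>t. f (x(i := t))) field_differentiable at (x i)) \<and>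
            Ck_on n k S (partial_deriv i f))"

definition Cinf_on :: "nat \<Rightarrow> (nat \<Rightarrow> real) set \<Rightarrow> ((nat \<Rightarrow> real) \<Rightarrow> real) \<Rightarrow> bool" where
  "Cinf_on n S f \<longleftrightarrow> (\<forall>k. Ck_on n k S f)"


subsection \<open>Smooth manifolds\<close>

text \<open>
  The manifold is the whole type \<open>'m\<close>, with its topology; a chart is a pair of its domain and
  its coordinate map. The atlas need not be maximal.
\<close>

record 'm manifold =
  mdim :: nat
  charts :: "('m set \<times> ('m \<Rightarrow> nat \<Rightarrow> real)) set"

definition smooth_manifold ::
  "('m::{t2_space,second_countable_topology}, 'z) manifold_scheme \<Rightarrow> bool" where
  "smooth_manifold M \<longleftrightarrow>
     (\<Union>(U,\<phi>)\<in>charts M. U) = UNIV \<and>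
     (\<forall>(U,\<phi>)\<in>charts M. open U \<and> openin (Euclidean_space (mdim M)) (\<phi> ` U) \<and>
        homeomorphic_map (top_of_set U) (subtopology (Euclidean_space (mdim M)) (\<phi> ` U)) \<phi>) \<and>
     (\<forall>(U,\<phi>)\<in>charts M. \<forall>(V,\<psi>)\<in>charts M. \<forall>i<mdim M.
        Cinf_on (mdim M) (\<phi> ` (U \<inter> V)) (\<lambda>y. \<psi> (inv_into U \<phi> y) i))"

definition smooth_on ::
  "('m::topological_space, 'z) manifold_scheme \<Rightarrow> 'm set \<Rightarrow> ('m \<Rightarrow> real) \<Rightarrow> bool" where
  "smooth_on M W f \<longleftrightarrow>
     (\<forall>(U,\<phi>)\<in>charts M. Cinf_on (mdim M) (\<phi> ` (U \<inter> W)) (\<lambda>y. f (inv_into U \<phi> y)))"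

definition smooth_functions ::
  "('m::topological_space, 'z) manifold_scheme \<Rightarrow> ('m \<Rightarrow> real) set" where
  "smooth_functions M = {f. smooth_on M UNIV f}"

text \<open>
  Tangent vectors at \<open>x\<close> are the derivations at \<open>x\<close> of the algebra of smooth functions. They are
  set to 0 on non-smooth arguments, so that equal tangent vectors are equal as HOL functions.
\<close>

definition tangent_space ::
  "('m::topological_space, 'z) manifold_scheme \<Rightarrow> 'm \<Rightarrow> (('m \<Rightarrow> real) \<Rightarrow> real) set" where
  "tangent_space M x = {D.
     (\<forall>f\<in>smooth_functions M. \<forall>g\<in>smooth_functions M. \<forall>a b.
        D (\<lambda>y. a * f y + b * g y) = a * D f + b * D g) \<and>
     (\<forall>f\<in>smooth_functions M. \<forall>g\<in>smooth_functions M.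
        D (\<lambda>y. f y * g y) = f x * D g + g x * D f) \<and>
     (\<forall>f. f \<notin> smooth_functions M \<longrightarrow> D f = 0)}"

text \<open>The coordinate vector \<open>\<partial>\<^sub>i\<close> at \<open>x\<close> of the chart \<open>(V, \<phi>)\<close>.\<close>

definition coord_vector ::
  "'m set \<Rightarrow> ('m \<Rightarrow> nat \<Rightarrow> real) \<Rightarrow> nat \<Rightarrow> 'm \<Rightarrow> ('m \<Rightarrow> real) \<Rightarrow> real" where
  "coord_vector V \<phi> i x f = partial_deriv i (\<lambda>y. f (inv_into V \<phi> y)) (\<phi> x)"


subsection \<open>Vector bundles, sections and forms\<close>

text \<open>
  A vector bundle is given by its fibres, which are subspaces of an arbitrary real vector space
  \<open>'e\<close>, and by a bundle atlas. The total space is the disjoint union of the fibres. A local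
  trivialization \<open>(x, c) \<mapsto> \<Sum>\<^sub>a c\<^sub>a X\<^sub>a(x)\<close> of \<open>E\<close> over \<open>U\<close> is recorded as the local frame
  \<open>(X\<^sub>a)\<close>, \<open>a < rk E\<close>. Note that no compatibility of the smooth structure with \<open>'e\<close> is assumed:
  smoothness of sections is determined by the frames alone, so the bundle may be nontrivial
  even if all its fibres are the same subspace.
\<close>

record ('m, 'e) vbundle = "'m manifold" +
  fibre :: "'m \<Rightarrow> 'e set"
  rk :: nat
  frames :: "('m set \<times> (nat \<Rightarrow> 'm \<Rightarrow> 'e)) set"

definition vector_bundle ::
  "('m::{t2_space,second_countable_topology}, 'e::real_vector) vbundle \<Rightarrow> bool" where
  "vector_bundle E \<longleftrightarrow>
     smooth_manifold E \<and>
     (\<Union>(U,X)\<in>frames E. U) = UNIV \<and>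
     (\<forall>(U,X)\<in>frames E. open U \<and>
        (\<forall>x\<in>U. inj_on (\<lambda>a. X a x) {..<rk E} \<and>
               independent ((\<lambda>a. X a x) ` {..<rk E}) \<and>
               span ((\<lambda>a. X a x) ` {..<rk E}) = fibre E x)) \<and>
     (\<forall>(U,X)\<in>frames E. \<forall>(V,Y)\<in>frames E. \<exists>g.
        (\<forall>a<rk E. \<forall>b<rk E. smooth_on E (U \<inter> V) (g a b)) \<and>
        (\<forall>x\<in>U \<inter> V. \<forall>b<rk E. Y b x = (\<Sum>a<rk E. g a b x *\<^sub>R X a x)))"

definition sections ::
  "('m::topological_space, 'e::real_vector) vbundle \<Rightarrow> ('m \<Rightarrow> 'e) set" where
  "sections E = {v.
     (\<forall>x. v x \<in> fibre E x) \<and>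
     (\<forall>(U,X)\<in>frames E. \<exists>c. (\<forall>a<rk E. smooth_on E U (c a)) \<and>
        (\<forall>x\<in>U. v x = (\<Sum>a<rk E. c a x *\<^sub>R X a x)))}"

text \<open>
  The \<open>p\<close>-forms, i.e. the smooth sections of \<open>\<Lambda>\<^sup>pE\<^sup>*\<close>: at each point an alternating
  \<open>p\<close>-multilinear map on the fibre, whose components in the local frames are smooth. The
  arguments are collected in a list of length \<open>p\<close>; a form is set to 0 on all other lists.
\<close>

definition forms ::
  "('m::topological_space, 'e::real_vector) vbundle \<Rightarrow> nat \<Rightarrow> ('m \<Rightarrow> 'e list \<Rightarrow> real) set" where
  "forms E p = {\<omega>.
     (\<forall>x es. \<not> (length es = p \<and> set es \<subseteq> fibre E x) \<longrightarrow> \<omega> x es = 0) \<and>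
     (\<forall>x es. length es = p \<and> set es \<subseteq> fibre E x \<longrightarrow>
        (\<forall>i<p. \<forall>e\<in>fibre E x. \<forall>e'\<in>fibre E x. \<forall>a b.
           \<omega> x (es[i := a *\<^sub>R e + b *\<^sub>R e']) = a * \<omega> x (es[i := e]) + b * \<omega> x (es[i := e'])) \<and>
        (\<forall>i<p. \<forall>j<p. i \<noteq> j \<and> es ! i = es ! j \<longrightarrow> \<omega> x es = 0)) \<and>
     (\<forall>(U,X)\<in>frames E. \<forall>ks. length ks = p \<and> set ks \<subseteq> {..<rk E} \<longrightarrow>
        smooth_on E U (\<lambda>x. \<omega> x (map (\<lambda>a. X a x) ks)))}"

definition lin_comb ::
  "('m \<Rightarrow> real) \<Rightarrow> ('m \<Rightarrow> 'e::real_vector) \<Rightarrow> ('m \<Rightarrow> real) \<Rightarrow> ('m \<Rightarrow> 'e) \<Rightarrow> 'm \<Rightarrow> 'e" where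
  "lin_comb f u g v = (\<lambda>x. f x *\<^sub>R u x + g x *\<^sub>R v x)"

definition R_bilinear ::
  "('m::topological_space, 'e::real_vector) vbundle \<Rightarrow>
    (('m \<Rightarrow> 'e) \<Rightarrow> ('m \<Rightarrow> 'e) \<Rightarrow> 'm \<Rightarrow> 'e) \<Rightarrow> bool" where
  "R_bilinear E B \<longleftrightarrow>
     (\<forall>u\<in>sections E. \<forall>v\<in>sections E. B u v \<in> sections E) \<and>
     (\<forall>u\<in>sections E. \<forall>v\<in>sections E. \<forall>w\<in>sections E. \<forall>a b.
        B (lin_comb (\<lambda>_. a) u (\<lambda>_. b) v) w = lin_comb (\<lambda>_. a) (B u w) (\<lambda>_. b) (B v w) \<and>
        B w (lin_comb (\<lambda>_. a) u (\<lambda>_. b) v) = lin_comb (\<lambda>_. a) (B w u) (\<lambda>_. b) (B w v))"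


subsection \<open>Local pre-Leibniz algebroids\<close>

text \<open>
  A bundle morphism \<open>\<rho> : E \<rightarrow> T(M)\<close> over the identity: fibrewise linear, with smooth matrix
  \<open>R\<close> with respect to local frames of \<open>E\<close> and coordinate frames of \<open>T(M)\<close>.
\<close>

definition anchor ::
  "('m::topological_space, 'e::real_vector) vbundle \<Rightarrow> ('m \<Rightarrow> 'e \<Rightarrow> ('m \<Rightarrow> real) \<Rightarrow> real) \<Rightarrow> bool" where
  "anchor E \<rho> \<longleftrightarrow>
     (\<forall>x. \<forall>e\<in>fibre E x. \<rho> x e \<in> tangent_space E x) \<and>
     (\<forall>x. \<forall>e\<in>fibre E x. \<forall>e'\<in>fibre E x. \<forall>a b f.
        \<rho> x (a *\<^sub>R e + b *\<^sub>R e') f = a * \<rho> x e f + b * \<rho> x e' f) \<and>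
     (\<forall>(U,X)\<in>frames E. \<forall>(V,\<phi>)\<in>charts E. \<exists>R.
        (\<forall>a<rk E. \<forall>i<mdim E. smooth_on E (U \<inter> V) (R a i)) \<and>
        (\<forall>x\<in>U \<inter> V. \<forall>a<rk E. \<forall>f\<in>smooth_functions E.
           \<rho> x (X a x) f = (\<Sum>i<mdim E. R a i x * coord_vector V \<phi> i x f)))"

text \<open>The function \<open>\<rho>(v)(f)\<close> for a section \<open>v\<close>.\<close>

definition act ::
  "('m \<Rightarrow> 'e \<Rightarrow> ('m \<Rightarrow> real) \<Rightarrow> real) \<Rightarrow> ('m \<Rightarrow> 'e) \<Rightarrow> ('m \<Rightarrow> real) \<Rightarrow> 'm \<Rightarrow> real" where
  "act \<rho> v f = (\<lambda>x. \<rho> x (v x) f)"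

definition ker_anchor ::
  "('m::topological_space, 'e::real_vector) vbundle \<Rightarrow> ('m \<Rightarrow> 'e \<Rightarrow> ('m \<Rightarrow> real) \<Rightarrow> real) \<Rightarrow>
    'm \<Rightarrow> 'e set" where
  "ker_anchor E \<rho> x = {e \<in> fibre E x. \<rho> x e = (\<lambda>_. 0)}"

definition regular_anchor ::
  "('m::topological_space, 'e::real_vector) vbundle \<Rightarrow> ('m \<Rightarrow> 'e \<Rightarrow> ('m \<Rightarrow> real) \<Rightarrow> real) \<Rightarrow> bool" where
  "regular_anchor E \<rho> \<longleftrightarrow>
     (\<forall>x. \<exists>U. open U \<and> x \<in> U \<and> (\<forall>y\<in>U. dim (ker_anchor E \<rho> y) = dim (ker_anchor E \<rho> x)))"

definition pre_Leibniz_algebroid ::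
  "('m::{t2_space,second_countable_topology}, 'e::real_vector) vbundle \<Rightarrow>
    ('m \<Rightarrow> 'e \<Rightarrow> ('m \<Rightarrow> real) \<Rightarrow> real) \<Rightarrow> (('m \<Rightarrow> 'e) \<Rightarrow> ('m \<Rightarrow> 'e) \<Rightarrow> 'm \<Rightarrow> 'e) \<Rightarrow> bool" where
  "pre_Leibniz_algebroid E \<rho> br \<longleftrightarrow>
     vector_bundle E \<and> anchor E \<rho> \<and> R_bilinear E br \<and>
     (\<forall>u\<in>sections E. \<forall>v\<in>sections E. \<forall>f\<in>smooth_functions E.
        br u (\<lambda>x. f x *\<^sub>R v x) = lin_comb (act \<rho> u f) v f (br u v)) \<and>
     (\<forall>u\<in>sections E. \<forall>v\<in>sections E. \<forall>f\<in>smooth_functions E. \<forall>x.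
        act \<rho> (br u v) f x = act \<rho> u (act \<rho> v f) x - act \<rho> v (act \<rho> u f) x)"

definition coboundary ::
  "('m::topological_space, 'e::real_vector) vbundle \<Rightarrow> ('m \<Rightarrow> 'e \<Rightarrow> ('m \<Rightarrow> real) \<Rightarrow> real) \<Rightarrow>
    ('m \<Rightarrow> real) \<Rightarrow> 'm \<Rightarrow> 'e list \<Rightarrow> real" where
  "coboundary E \<rho> f = (\<lambda>x es.
     if length es = 1 \<and> set es \<subseteq> fibre E x then \<rho> x (hd es) f else 0)"

definition C_multilinear ::
  "('m::topological_space, 'e::real_vector) vbundle \<Rightarrow>
    (('m \<Rightarrow> 'e list \<Rightarrow> real) \<Rightarrow> ('m \<Rightarrow> 'e) \<Rightarrow> ('m \<Rightarrow> 'e) \<Rightarrow> 'm \<Rightarrow> 'e) \<Rightarrow> bool" where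
  "C_multilinear E L \<longleftrightarrow>
     (\<forall>\<alpha>\<in>forms E 1. \<forall>u\<in>sections E. \<forall>v\<in>sections E. L \<alpha> u v \<in> sections E) \<and>
     (\<forall>\<alpha>\<in>forms E 1. \<forall>\<beta>\<in>forms E 1. \<forall>u\<in>sections E. \<forall>v\<in>sections E.
      \<forall>f\<in>smooth_functions E. \<forall>g\<in>smooth_functions E.
        L (\<lambda>x es. f x * \<alpha> x es + g x * \<beta> x es) u v = lin_comb f (L \<alpha> u v) g (L \<beta> u v)) \<and>
     (\<forall>\<alpha>\<in>forms E 1. \<forall>u\<in>sections E. \<forall>v\<in>sections E. \<forall>w\<in>sections E.
      \<forall>f\<in>smooth_functions E. \<forall>g\<in>smooth_functions E.
        L \<alpha> (lin_comb f u g v) w = lin_comb f (L \<alpha> u w) g (L \<alpha> v w) \<and>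
        L \<alpha> w (lin_comb f u g v) = lin_comb f (L \<alpha> w u) g (L \<alpha> w v))"

definition local_pre_Leibniz_algebroid ::
  "('m::{t2_space,second_countable_topology}, 'e::real_vector) vbundle \<Rightarrow>
    ('m \<Rightarrow> 'e \<Rightarrow> ('m \<Rightarrow> real) \<Rightarrow> real) \<Rightarrow> (('m \<Rightarrow> 'e) \<Rightarrow> ('m \<Rightarrow> 'e) \<Rightarrow> 'm \<Rightarrow> 'e) \<Rightarrow>
    (('m \<Rightarrow> 'e list \<Rightarrow> real) \<Rightarrow> ('m \<Rightarrow> 'e) \<Rightarrow> ('m \<Rightarrow> 'e) \<Rightarrow> 'm \<Rightarrow> 'e) \<Rightarrow> bool" where
  "local_pre_Leibniz_algebroid E \<rho> br L \<longleftrightarrow>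
     pre_Leibniz_algebroid E \<rho> br \<and> C_multilinear E L \<and>
     (\<forall>u\<in>sections E. \<forall>v\<in>sections E. \<forall>f\<in>smooth_functions E. \<forall>x.
        br (\<lambda>x. f x *\<^sub>R u x) v x =
          - (act \<rho> v f x *\<^sub>R u x) + f x *\<^sub>R br u v x + L (coboundary E \<rho> f) u v x)"

definition locality_projector ::
  "('m::topological_space, 'e::real_vector) vbundle \<Rightarrow> ('m \<Rightarrow> 'e \<Rightarrow> ('m \<Rightarrow> real) \<Rightarrow> real) \<Rightarrow>
    (('m \<Rightarrow> 'e list \<Rightarrow> real) \<Rightarrow> ('m \<Rightarrow> 'e) \<Rightarrow> ('m \<Rightarrow> 'e) \<Rightarrow> 'm \<Rightarrow> 'e) \<Rightarrow>
    (('m \<Rightarrow> 'e) \<Rightarrow> 'm \<Rightarrow> 'e) \<Rightarrow> bool" where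
  "locality_projector E \<rho> L P \<longleftrightarrow>
     (\<forall>u\<in>sections E. P u \<in> sections E) \<and>
     (\<forall>u\<in>sections E. \<forall>v\<in>sections E. \<forall>f\<in>smooth_functions E. \<forall>g\<in>smooth_functions E.
        P (lin_comb f u g v) = lin_comb f (P u) g (P v)) \<and>
     (\<forall>\<alpha>\<in>forms E 1. \<forall>u\<in>sections E. \<forall>v\<in>sections E. \<forall>x. P (L \<alpha> u v) x \<in> ker_anchor E \<rho> x) \<and>
     (\<forall>u\<in>sections E. (\<forall>x. u x \<in> ker_anchor E \<rho> x) \<longrightarrow> P u = u)"


subsection \<open>Admissible connections and modified brackets\<close>

definition linear_E_connection ::
  "('m::topological_space, 'e::real_vector) vbundle \<Rightarrow> ('m \<Rightarrow> 'e \<Rightarrow> ('m \<Rightarrow> real) \<Rightarrow> real) \<Rightarrow>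
    (('m \<Rightarrow> 'e) \<Rightarrow> ('m \<Rightarrow> 'e) \<Rightarrow> 'm \<Rightarrow> 'e) \<Rightarrow> bool" where
  "linear_E_connection E \<rho> nabla \<longleftrightarrow>
     R_bilinear E nabla \<and>
     (\<forall>u\<in>sections E. \<forall>v\<in>sections E. \<forall>f\<in>smooth_functions E.
        nabla u (\<lambda>x. f x *\<^sub>R v x) = lin_comb (act \<rho> u f) v f (nabla u v) \<and>
        nabla (\<lambda>x. f x *\<^sub>R u x) v = (\<lambda>x. f x *\<^sub>R nabla u v x))"

text \<open>
  A local frame \<open>(X\<^sub>a)\<close> with dual coframe \<open>(e\<^sup>a)\<close> around \<open>x\<close>. Since \<open>L\<close> and \<open>\<nabla>\<close> act on global
  sections, \<open>X\<^sub>a\<close> and \<open>e\<^sup>a\<close> are global objects that are dual to each other (hence form a frame and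
  its dual coframe) on a neighbourhood of \<open>x\<close>; every local frame near \<open>x\<close> is of this kind
  after shrinking its domain.
\<close>

definition frame_around ::
  "('m::topological_space, 'e::real_vector) vbundle \<Rightarrow> 'm \<Rightarrow>
    (nat \<Rightarrow> 'm \<Rightarrow> 'e) \<Rightarrow> (nat \<Rightarrow> 'm \<Rightarrow> 'e list \<Rightarrow> real) \<Rightarrow> bool" where
  "frame_around E x X \<epsilon> \<longleftrightarrow>
     (\<forall>a<rk E. X a \<in> sections E \<and> \<epsilon> a \<in> forms E 1) \<and>
     (\<exists>U. open U \<and> x \<in> U \<and>
        (\<forall>y\<in>U. \<forall>a<rk E. \<forall>b<rk E. \<epsilon> a y [X b y] = (if a = b then 1 else 0)))"

text \<open>
  The section \<open>K(e\<^sup>a, \<nabla>\<^bsub>X\<^sub>a\<^esub> u, v)\<close> for \<open>K = L\<close> or \<open>K = \<P>L\<close>. Its value at \<open>x\<close> is computed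
  in some local frame around \<open>x\<close>; by tensoriality it does not depend on the choice.
\<close>

definition contraction ::
  "('m::topological_space, 'e::real_vector) vbundle \<Rightarrow>
    (('m \<Rightarrow> 'e list \<Rightarrow> real) \<Rightarrow> ('m \<Rightarrow> 'e) \<Rightarrow> ('m \<Rightarrow> 'e) \<Rightarrow> 'm \<Rightarrow> 'e) \<Rightarrow>
    (('m \<Rightarrow> 'e) \<Rightarrow> ('m \<Rightarrow> 'e) \<Rightarrow> 'm \<Rightarrow> 'e) \<Rightarrow> ('m \<Rightarrow> 'e) \<Rightarrow> ('m \<Rightarrow> 'e) \<Rightarrow> 'm \<Rightarrow> 'e" where
  "contraction E K nabla u v = (\<lambda>x.
     let (X, \<epsilon>) = (SOME (X, \<epsilon>). frame_around E x X \<epsilon>)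
     in \<Sum>a<rk E. K (\<epsilon> a) (nabla (X a) u) v x)"

definition admissible ::
  "('m::topological_space, 'e::real_vector) vbundle \<Rightarrow> (('m \<Rightarrow> 'e) \<Rightarrow> ('m \<Rightarrow> 'e) \<Rightarrow> 'm \<Rightarrow> 'e) \<Rightarrow>
    (('m \<Rightarrow> 'e list \<Rightarrow> real) \<Rightarrow> ('m \<Rightarrow> 'e) \<Rightarrow> ('m \<Rightarrow> 'e) \<Rightarrow> 'm \<Rightarrow> 'e) \<Rightarrow>
    (('m \<Rightarrow> 'e) \<Rightarrow> ('m \<Rightarrow> 'e) \<Rightarrow> 'm \<Rightarrow> 'e) \<Rightarrow> bool" where
  "admissible E br L nabla \<longleftrightarrow>
     (\<forall>u\<in>sections E. \<forall>v\<in>sections E. \<forall>x.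
        br u v x + br v u x = contraction E L nabla u v x + contraction E L nabla v u x)"

definition modified_bracket ::
  "('m::topological_space, 'e::real_vector) vbundle \<Rightarrow> (('m \<Rightarrow> 'e) \<Rightarrow> ('m \<Rightarrow> 'e) \<Rightarrow> 'm \<Rightarrow> 'e) \<Rightarrow>
    (('m \<Rightarrow> 'e list \<Rightarrow> real) \<Rightarrow> ('m \<Rightarrow> 'e) \<Rightarrow> ('m \<Rightarrow> 'e) \<Rightarrow> 'm \<Rightarrow> 'e) \<Rightarrow>
    (('m \<Rightarrow> 'e) \<Rightarrow> ('m \<Rightarrow> 'e) \<Rightarrow> 'm \<Rightarrow> 'e) \<Rightarrow> ('m \<Rightarrow> 'e) \<Rightarrow> ('m \<Rightarrow> 'e) \<Rightarrow> 'm \<Rightarrow> 'e" where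
  "modified_bracket E br L nabla u v = (\<lambda>x. br u v x - contraction E L nabla u v x)"

definition projected_modified_bracket ::
  "('m::topological_space, 'e::real_vector) vbundle \<Rightarrow> (('m \<Rightarrow> 'e) \<Rightarrow> ('m \<Rightarrow> 'e) \<Rightarrow> 'm \<Rightarrow> 'e) \<Rightarrow>
    (('m \<Rightarrow> 'e list \<Rightarrow> real) \<Rightarrow> ('m \<Rightarrow> 'e) \<Rightarrow> ('m \<Rightarrow> 'e) \<Rightarrow> 'm \<Rightarrow> 'e) \<Rightarrow>
    (('m \<Rightarrow> 'e) \<Rightarrow> 'm \<Rightarrow> 'e) \<Rightarrow>
    (('m \<Rightarrow> 'e) \<Rightarrow> ('m \<Rightarrow> 'e) \<Rightarrow> 'm \<Rightarrow> 'e) \<Rightarrow> ('m \<Rightarrow> 'e) \<Rightarrow> ('m \<Rightarrow> 'e) \<Rightarrow> 'm \<Rightarrow> 'e" where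
  "projected_modified_bracket E br L P nabla u v =
     (\<lambda>x. br u v x - contraction E (\<lambda>\<alpha> u v. P (L \<alpha> u v)) nabla u v x)"


subsection \<open>Cartan calculus\<close>

text \<open>
  The operators act on forms through their values on sections, i.e. on the maps
  \<open>(v\<^sub>1, \<dots>, v\<^sub>p) \<mapsto> \<Omega>(v\<^sub>1, \<dots>, v\<^sub>p)\<close> from lists of sections to functions. For \<open>\<omega> \<in> forms E p\<close> the map
  \<open>on_sections \<omega>\<close> vanishes on lists of any length other than \<open>p\<close>; in particular
  \<open>interior_product v (on_sections f)\<close> is the zero map for a 0-form \<open>f\<close>.
\<close>

definition on_sections ::
  "('m \<Rightarrow> 'e list \<Rightarrow> real) \<Rightarrow> ('m \<Rightarrow> 'e) list \<Rightarrow> 'm \<Rightarrow> real" where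
  "on_sections \<omega> vs = (\<lambda>x. \<omega> x (map (\<lambda>v. v x) vs))"

definition interior_product ::
  "('m \<Rightarrow> 'e) \<Rightarrow> (('m \<Rightarrow> 'e) list \<Rightarrow> 'm \<Rightarrow> real) \<Rightarrow> ('m \<Rightarrow> 'e) list \<Rightarrow> 'm \<Rightarrow> real" where
  "interior_product v \<Omega> vs = \<Omega> (v # vs)"

text \<open>
  List positions start at 0, whence the sign \<open>(-1)\<^sup>i\<close> in place of \<open>(-1)\<^sup>i\<^sup>+\<^sup>1\<close> in the first sum.
  The list \<open>nths vs (- {i, j})\<close> is \<open>vs\<close> with the entries at positions \<open>i\<close> and \<open>j\<close> omitted.
\<close>

definition exterior_derivative ::
  "('m \<Rightarrow> 'e \<Rightarrow> ('m \<Rightarrow> real) \<Rightarrow> real) \<Rightarrow> (('m \<Rightarrow> 'e) \<Rightarrow> ('m \<Rightarrow> 'e) \<Rightarrow> 'm \<Rightarrow> 'e) \<Rightarrow>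
    (('m \<Rightarrow> 'e) list \<Rightarrow> 'm \<Rightarrow> real) \<Rightarrow> ('m \<Rightarrow> 'e) list \<Rightarrow> 'm \<Rightarrow> real" where
  "exterior_derivative \<rho> B \<Omega> vs = (\<lambda>x.
     (\<Sum>i<length vs. (-1) ^ i * act \<rho> (vs ! i) (\<Omega> (nths vs (- {i}))) x) +
     (\<Sum>j<length vs. \<Sum>i<j. (-1) ^ (i + j) * \<Omega> (B (vs ! i) (vs ! j) # nths vs (- {i, j})) x))"

definition Leibniz_derivative ::
  "('m \<Rightarrow> 'e \<Rightarrow> ('m \<Rightarrow> real) \<Rightarrow> real) \<Rightarrow> (('m \<Rightarrow> 'e) \<Rightarrow> ('m \<Rightarrow> 'e) \<Rightarrow> 'm \<Rightarrow> 'e) \<Rightarrow> ('m \<Rightarrow> 'e) \<Rightarrow>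
    (('m \<Rightarrow> 'e) list \<Rightarrow> 'm \<Rightarrow> real) \<Rightarrow> ('m \<Rightarrow> 'e) list \<Rightarrow> 'm \<Rightarrow> real" where
  "Leibniz_derivative \<rho> B v \<Omega> vs = (\<lambda>x.
     act \<rho> v (\<Omega> vs) x - (\<Sum>i<length vs. \<Omega> (vs[i := B v (vs ! i)]) x))"

end

theory Submission
  imports Defs
begin

text \<open>
  Both formulas hold for an arbitrary bracket \<open>B\<close> in place of the modified ones. In
  \<open>(\<iota>\<^sub>v d\<Omega>)(v\<^sub>1, \<dots>, v\<^sub>p)\<close> the terms in which \<open>v\<close> is differentiated along or bracketed give
  \<open>\<L>\<^sub>v\<Omega>\<close>, once \<open>B v v\<^sub>i\<close> is moved from the first position to the \<open>i\<close>-th, and the remaining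
  terms cancel against \<open>d \<iota>\<^sub>v\<Omega>\<close>, once \<open>v\<close> and \<open>B v\<^sub>i v\<^sub>j\<close> are interchanged. So only the fact that
  \<open>\<Omega>\<close> is alternating enters.
\<close>

text \<open>Every point lies in the domain of some local frame, and the fibre there is a
  span.\<close>

lemma subspace_fibre:
  assumes "vector_bundle E"
  shows "subspace (fibre E x)"
proof -
  have "x \<in> (\<Union>(U,X)\<in>frames E. U)"
    using assms by (simp add: vector_bundle_def)
  then obtain U X where "(U, X) \<in> frames E" "x \<in> U"
    by auto
  then have "span ((\<lambda>a. X a x) ` {..<rk E}) = fibre E x"
    using assms unfolding vector_bundle_def by fast
  then show ?thesis
    by (metis subspace_span)
qed

text \<open>Polarization: \<open>forms\<close> only demands vanishing on repeated entries, and
  expanding the value at \<open>e + e'\<close> in both slots yields the sign.\<close>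

lemma forms_swap:
  assumes \<omega>: "\<omega> \<in> forms E p" and sub: "subspace (fibre E x)"
  shows "\<omega> x (as @ e # e' # bs) = - \<omega> x (as @ e' # e # bs)"
proof (cases "length (as @ e # e' # bs) = p \<and> set (as @ e # e' # bs) \<subseteq> fibre E x")
  case False
  \<comment> \<open>Both lists have the same length and entries, so the default value 0 applies to
    both.\<close>
  then have "\<omega> x (as @ e # e' # bs) = 0" "\<omega> x (as @ e' # e # bs) = 0"
    using \<omega> by (auto simp: forms_def)
  then show ?thesis by simp
next
  case True
  let ?F = "fibre E x" and ?n = "length as"
  define T where "T a b = \<omega> x (as @ a # b # bs)" for a b
  have e: "e \<in> ?F" "e' \<in> ?F" and s: "e + e' \<in> ?F"
    using True sub by (auto intro: subspace_add)
  have lin: "\<omega> x (es[i := c + c']) = \<omega> x (es[i := c]) + \<omega> x (es[i := c'])"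
    if "length es = p" "set es \<subseteq> ?F" "i < p" "c \<in> ?F" "c' \<in> ?F" for es i c c'
  proof -
    have "\<omega> x (es[i := 1 *\<^sub>R c + 1 *\<^sub>R c']) = 1 * \<omega> x (es[i := c]) + 1 * \<omega> x (es[i := c'])"
      using \<omega> that unfolding forms_def by blast
    then show ?thesis by simp
  qed
  have left: "T (a + a') b = T a b + T a' b" if "a \<in> ?F" "a' \<in> ?F" "b \<in> ?F" for a a' b
    using lin[of "as @ a # b # bs" ?n a a'] True that by (simp add: T_def list_update_append)
  have right: "T a (b + b') = T a b + T a b'" if "a \<in> ?F" "b \<in> ?F" "b' \<in> ?F" for a b b'
    using lin[of "as @ a # b # bs" "Suc ?n" b b'] True that
    by (simp add: T_def list_update_append)
  have alt: "T a a = 0" if "a \<in> ?F" for a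
  proof -
    have "length (as @ a # a # bs) = p \<and> set (as @ a # a # bs) \<subseteq> ?F"
      using True that by auto
    moreover have "?n < p" "Suc ?n < p" "?n \<noteq> Suc ?n"
      "(as @ a # a # bs) ! ?n = (as @ a # a # bs) ! Suc ?n"
      using True by (auto simp: nth_append)
    ultimately show ?thesis
      using \<omega> unfolding forms_def T_def by blast
  qed
  have "0 = T (e + e') (e + e')"
    using alt[OF s] by simp
  also have "\<dots> = T e e' + T e' e"
    using e s by (simp add: left right alt[OF e(1)] alt[OF e(2)])
  finally show ?thesis
    by (simp add: T_def)
qed

text \<open>Each entry of \<open>as\<close> that \<open>e\<close> passes costs one swap. The last
  one is passed first and joins the tail, so \<open>bs\<close> must vary in the induction.\<close>

lemma forms_move_to_front:
  assumes "\<omega> \<in> forms E p" "subspace (fibre E x)"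
  shows "\<omega> x (as @ e # bs) = (- 1) ^ length as * \<omega> x (e # as @ bs)"
proof (induction as arbitrary: bs rule: rev_induct)
  case (snoc a as)
  then show ?case
    using forms_swap[OF assms, of as a e bs] by simp
qed simp

text \<open>Links the omission used in the exterior derivative to the take/drop form of a list
  update.\<close>

lemma nths_Compl_singleton:
  "j < length xs \<Longrightarrow> nths xs (- {j}) = take j xs @ drop (Suc j) xs"
proof (induction xs arbitrary: j)
  case (Cons a xs)
  have "{k. Suc k \<in> - {Suc i}} = - {i}" for i by auto
  then show ?case
    using Cons by (cases j) (simp_all add: nths_Cons nths_all)
qed simp

lemma forms_list_update:
  assumes "\<omega> \<in> forms E p" "subspace (fibre E x)" "j < length es"
  shows "\<omega> x (es[j := e]) = (- 1) ^ j * \<omega> x (e # nths es (- {j}))"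
  using forms_move_to_front[OF assms(1,2), of "take j es" e "drop (Suc j) es"] assms(3)
  by (simp add: upd_conv_take_nth_drop nths_Compl_singleton)

lemma nths_Cons_Compl:
  "nths (v # vs) (- {0}) = vs"
  "nths (v # vs) (- {Suc j}) = v # nths vs (- {j})"
  "nths (v # vs) (- {0, Suc j}) = nths vs (- {j})"
  "nths (v # vs) (- {Suc i, Suc j}) = v # nths vs (- {i, j})"
proof -
  have "{k. Suc k \<in> - {0}} = UNIV" "{k. Suc k \<in> - {Suc j}} = - {j}"
    "{k. Suc k \<in> - {0, Suc j}} = - {j}" "{k. Suc k \<in> - {Suc i, Suc j}} = - {i, j}"
    by auto
  then show
    "nths (v # vs) (- {0}) = vs"
    "nths (v # vs) (- {Suc j}) = v # nths vs (- {j})"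
    "nths (v # vs) (- {0, Suc j}) = nths vs (- {j})"
    "nths (v # vs) (- {Suc i, Suc j}) = v # nths vs (- {i, j})"
    unfolding nths_Cons by (simp_all add: nths_all)
qed

text \<open>Position 0, held by \<open>v\<close>, is split off both sums. Shifting one index flips
  the sign, as for the pairs \<open>(0, Suc i)\<close> and in the first sum; shifting both indices
  of a pair preserves it.\<close>

lemma exterior_derivative_Cons:
  "exterior_derivative \<rho> B \<Omega> (v # vs) x =
     act \<rho> v (\<Omega> vs) x - (\<Sum>i<length vs. (- 1) ^ i * \<Omega> (B v (vs ! i) # nths vs (- {i})) x) -
     (\<Sum>i<length vs. (- 1) ^ i * act \<rho> (vs ! i) (\<Omega> (v # nths vs (- {i}))) x) +
     (\<Sum>j<length vs. \<Sum>i<j.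
        (- 1) ^ (i + j) * \<Omega> (B (vs ! i) (vs ! j) # v # nths vs (- {i, j})) x)"
  unfolding exterior_derivative_def
  \<comment> \<open>The deleted rule would split off the last index instead of the first.\<close>
  by (simp add: sum.lessThan_Suc_shift nths_Cons_Compl sum.distrib sum_subtractf sum_negf
      del: sum.lessThan_Suc)

lemma Cartan_magic:
  assumes \<omega>: "\<omega> \<in> forms E p" and sub: "\<And>x. subspace (fibre E x)"
  shows "Leibniz_derivative \<rho> B v (on_sections \<omega>) vs =
    (\<lambda>x. exterior_derivative \<rho> B (interior_product v (on_sections \<omega>)) vs x +
          interior_product v (exterior_derivative \<rho> B (on_sections \<omega>)) vs x)"
proof
  fix x
  have swap: "on_sections \<omega> (u # w # us) x = - on_sections \<omega> (w # u # us) x" for u w us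
    using forms_swap[OF \<omega> sub, of x "[]" "u x" "w x" "map (\<lambda>v. v x) us"]
    by (simp add: on_sections_def)
  have move: "on_sections \<omega> (vs[i := u]) x = (- 1) ^ i * on_sections \<omega> (u # nths vs (- {i})) x"
    if "i < length vs" for i u
    \<comment> \<open>Evaluation at \<open>x\<close> commutes with updating and omitting
      entries.\<close>
    using forms_list_update[OF \<omega> sub, of i "map (\<lambda>v. v x) vs" x] that
    by (simp add: on_sections_def map_update nths_map)
  have "(\<Sum>i<length vs. on_sections \<omega> (vs[i := B v (vs ! i)]) x) =
      (\<Sum>i<length vs. (- 1) ^ i * on_sections \<omega> (B v (vs ! i) # nths vs (- {i})) x)"
    by (intro sum.cong refl move) simp
  moreover have "(\<Sum>j<length vs. \<Sum>i<j. (- 1) ^ (i + j) *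
        on_sections \<omega> (B (vs ! i) (vs ! j) # v # nths vs (- {i, j})) x) =
      - (\<Sum>j<length vs. \<Sum>i<j. (- 1) ^ (i + j) *
        on_sections \<omega> (v # B (vs ! i) (vs ! j) # nths vs (- {i, j})) x)"
    \<comment> \<open>A single substitution, since the right-hand side of \<open>swap\<close>
      matches its left-hand side again.\<close>
    by (subst swap) (simp add: sum_negf)
  moreover have "exterior_derivative \<rho> B (interior_product v (on_sections \<omega>)) vs x =
      (\<Sum>i<length vs. (- 1) ^ i * act \<rho> (vs ! i) (on_sections \<omega> (v # nths vs (- {i}))) x) +
      (\<Sum>j<length vs. \<Sum>i<j. (- 1) ^ (i + j) *
        on_sections \<omega> (v # B (vs ! i) (vs ! j) # nths vs (- {i, j})) x)"
    by (simp add: exterior_derivative_def interior_product_def)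
  ultimately show "Leibniz_derivative \<rho> B v (on_sections \<omega>) vs x =
      exterior_derivative \<rho> B (interior_product v (on_sections \<omega>)) vs x +
      interior_product v (exterior_derivative \<rho> B (on_sections \<omega>)) vs x"
    by (simp add: Leibniz_derivative_def interior_product_def exterior_derivative_Cons)
qed

theorem proposition3p16:
  fixes E :: "('m::{t2_space,second_countable_topology}, 'e::real_vector) vbundle"
    and \<rho> :: "'m \<Rightarrow> 'e \<Rightarrow> ('m \<Rightarrow> real) \<Rightarrow> real"
    and br nabla :: "('m \<Rightarrow> 'e) \<Rightarrow> ('m \<Rightarrow> 'e) \<Rightarrow> 'm \<Rightarrow> 'e"
    and L :: "('m \<Rightarrow> 'e list \<Rightarrow> real) \<Rightarrow> ('m \<Rightarrow> 'e) \<Rightarrow> ('m \<Rightarrow> 'e) \<Rightarrow> 'm \<Rightarrow> 'e"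
    and P :: "('m \<Rightarrow> 'e) \<Rightarrow> 'm \<Rightarrow> 'e"
  assumes "local_pre_Leibniz_algebroid E \<rho> br L"
    and "regular_anchor E \<rho>"
    and "locality_projector E \<rho> L P"
    and "linear_E_connection E \<rho> nabla"
    and "admissible E br L nabla"
  shows "\<forall>v\<in>sections E. \<forall>p. \<forall>\<omega>\<in>forms E p. \<forall>vs. length vs = p \<and> set vs \<subseteq> sections E \<longrightarrow>
    Leibniz_derivative \<rho> (modified_bracket E br L nabla) v (on_sections \<omega>) vs =
      (\<lambda>x. exterior_derivative \<rho> (modified_bracket E br L nabla)
              (interior_product v (on_sections \<omega>)) vs x +
            interior_product v
              (exterior_derivative \<rho> (modified_bracket E br L nabla) (on_sections \<omega>)) vs x) \<and>
    Leibniz_derivative \<rho> (projected_modified_bracket E br L P nabla) v (on_sections \<omega>) vs =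
      (\<lambda>x. exterior_derivative \<rho> (projected_modified_bracket E br L P nabla)
              (interior_product v (on_sections \<omega>)) vs x +
            interior_product v
              (exterior_derivative \<rho> (projected_modified_bracket E br L P nabla)
                (on_sections \<omega>)) vs x)"
proof -
  have "subspace (fibre E x)" for x
    using assms(1) subspace_fibre
    by (auto simp: local_pre_Leibniz_algebroid_def pre_Leibniz_algebroid_def)
  then show ?thesis
    \<comment> \<open>The two conjuncts instantiate \<open>B\<close> with the modified and the
      projected modified bracket.\<close>
    by (intro ballI allI impI conjI) (erule Cartan_magic, assumption)+
qed

end
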